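(* Let $d$ be a positive integer and let $\Gamma$ be a weighted graph with $v$ vertices and $l$ edges. Then the cluster state creation operator $\mathbf{u}_\Gamma$ on $l_2(\mathbb{Z}_d^V)$ can be decomposed into a product of $v+l$ unitary operations, each of which is a local Fourier transform $F_i$ ($i\in V$) or a controlled shift gate $\mathbf{c}(i,j)^n$ ($i,j\in V$, $i\neq j$, $n\in\mathbb{Z}$).
   Context: Fix a positive integer $d$ (number of levels), and write $\mathbb{Z}_d$ for the cyclic group (ring) of integers mod $d$. For $g,h\in\mathbb{Z}_d$ put $\chi(g|h)=\exp\left(\frac{2\pi i}{d}gh\right)$. A weighted graph $\Gamma$ on a finite vertex set $V$ is a symmetric matrix $\Gamma=(\Gamma(i,j)\mid i,j\in V)$ of integers, with no self-links: $\Gamma(i,j)$ is the weight of the edge $\{i,j\}$ ($i\ne j$), and $\Gamma(i,j)=0$ means there is no edge between $i$ and $j$. The number of edges is the number of two-element subsets $\{i,j\}\subset V$ with $\Gamma(i,j)\neq 0$. $l_2(\mathbb{Z}_d^V)$ is the Hilbert space of complex functions on $\mathbb{Z}_d^V$, with orthonormal (computational) basis $\{|\mathbf{g}\rangle : \mathbf{g}=(g_i)_{i\in V}\in\mathbb{Z}_d^V\}$. Local Fourier transform at $i\in V$: the unitary $F_i|\mathbf{g}\rangle=\frac{1}{\sqrt d}\sum_{h\in\mathbb{Z}_d}\chi(g_i|h)\,|h,\mathbf{g}^i\rangle$, where $|h,\mathbf{g}^i\rangle$ is the basis vector obtained from $|\mathbf g\rangle$ by replacing the $i$-th entry $g_i$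 by $h$. $n$-controlled shift gate with control $i$ and target $j\neq i$, for $n\in\mathbb{Z}$: the unitary $\mathbf{c}(i,j)^n|\mathbf{g}\rangle=|g_j+ng_i,\mathbf{g}^j\rangle$, i.e. the $j$-th entry $g_j$ is replaced by $g_j+ng_i$. For every integer $n$ this counts as a single controlled shift gate. $n$-controlled phase gate: $\mathbf{u}(i,j)^n=F_j\,\mathbf{c}(i,j)^n\,F_j^*=F_i\,\mathbf{c}(j,i)^n\,F_i^*$; it maps $|\mathbf g\rangle$ to $\chi(g_i|g_j)^n|\mathbf g\rangle$. Cluster state creation operator: $\mathbf{u}_\Gamma=\left(\prod_{\{i,j\}\subset V}\mathbf{u}(i,j)^{\Gamma(i,j)}\right)\prod_{j\in V}F_j$, where the first product is over all two-element subsets of $V$ (the factors commute). *)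

theory Defs
  imports "HOL-Analysis.Analysis"
begin

text \<open>The ring \<open>\<int>\<^sub>d\<close> is represented by the residues \<open>{0..<int d}\<close> with arithmetic modulo \<open>d\<close>.\<close>

definition labels :: "nat \<Rightarrow> 'v set \<Rightarrow> ('v \<Rightarrow> int) set" where
  "labels d V = (V \<rightarrow>\<^sub>E {0..<int d})"

text \<open>Complex functions on \<open>\<int>\<^sub>d\<^sup>V\<close> are represented by functions vanishing off \<open>labels d V\<close>.\<close>

definition l2 :: "nat \<Rightarrow> 'v set \<Rightarrow> (('v \<Rightarrow> int) \<Rightarrow> complex) set" where
  "l2 d V = {\<psi>. \<forall>g. g \<notin> labels d V \<longrightarrow> \<psi> g = 0}"

type_synonym 'v operator = "(('v \<Rightarrow> int) \<Rightarrow> complex) \<Rightarrow> (('v \<Rightarrow> int) \<Rightarrow> complex)"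

definition ket :: "('v \<Rightarrow> int) \<Rightarrow> ('v \<Rightarrow> int) \<Rightarrow> complex" where
  "ket g = (\<lambda>h. if h = g then 1 else 0)"

definition inner_l2 ::
    "nat \<Rightarrow> 'v set \<Rightarrow> (('v \<Rightarrow> int) \<Rightarrow> complex) \<Rightarrow> (('v \<Rightarrow> int) \<Rightarrow> complex) \<Rightarrow> complex" where
  "inner_l2 d V \<phi> \<psi> = (\<Sum>g\<in>labels d V. cnj (\<phi> g) * \<psi> g)"

text \<open>The linear operator whose value at each basis vector \<open>ket g\<close> is \<open>B g\<close>.\<close>

definition lin_ext :: "nat \<Rightarrow> 'v set \<Rightarrow> (('v \<Rightarrow> int) \<Rightarrow> ('v \<Rightarrow> int) \<Rightarrow> complex) \<Rightarrow> 'v operator" where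
  "lin_ext d V B = (\<lambda>\<psi> h. \<Sum>g\<in>labels d V. \<psi> g * B g h)"

text \<open>The adjoint in coordinates; see \<open>inner_adjoint\<close> below for its defining property.\<close>

definition adjoint_op :: "nat \<Rightarrow> 'v set \<Rightarrow> 'v operator \<Rightarrow> 'v operator" where
  "adjoint_op d V A = (\<lambda>\<psi> g. if g \<in> labels d V then inner_l2 d V (A (ket g)) \<psi> else 0)"

definition linear_op :: "nat \<Rightarrow> 'v set \<Rightarrow> 'v operator \<Rightarrow> bool" where
  "linear_op d V A \<longleftrightarrow>
     (\<forall>\<psi>\<in>l2 d V. A \<psi> \<in> l2 d V) \<and>
     (\<forall>\<phi>\<in>l2 d V. \<forall>\<psi>\<in>l2 d V. A (\<lambda>g. \<phi> g + \<psi> g) = (\<lambda>g. A \<phi> g + A \<psi> g)) \<and>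
     (\<forall>c. \<forall>\<psi>\<in>l2 d V. A (\<lambda>g. c * \<psi> g) = (\<lambda>g. c * A \<psi> g))"

definition unitary_op :: "nat \<Rightarrow> 'v set \<Rightarrow> 'v operator \<Rightarrow> bool" where
  "unitary_op d V A \<longleftrightarrow> linear_op d V A \<and>
     (\<forall>\<psi>\<in>l2 d V. adjoint_op d V A (A \<psi>) = \<psi> \<and> A (adjoint_op d V A \<psi>) = \<psi>)"

definition chi :: "nat \<Rightarrow> int \<Rightarrow> int \<Rightarrow> complex" where
  "chi d g h = exp (2 * of_real pi * \<i> / of_nat d * of_int (g * h))"

definition fourier :: "nat \<Rightarrow> 'v set \<Rightarrow> 'v \<Rightarrow> 'v operator" where
  "fourier d V i = lin_ext d V (\<lambda>g x.
     1 / of_real (sqrt (real d)) * (\<Sum>h\<in>{0..<int d}. chi d (g i) h * ket (g(i := h)) x))"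

text \<open>\<open>cshift d V n i j\<close> is the gate \<open>c(i,j)\<^sup>n\<close>, with control \<open>i\<close> and target \<open>j\<close>.\<close>

definition cshift :: "nat \<Rightarrow> 'v set \<Rightarrow> int \<Rightarrow> 'v \<Rightarrow> 'v \<Rightarrow> 'v operator" where
  "cshift d V n i j = lin_ext d V (\<lambda>g. ket (g(j := (g j + n * g i) mod int d)))"

definition cphase :: "nat \<Rightarrow> 'v set \<Rightarrow> int \<Rightarrow> 'v \<Rightarrow> 'v \<Rightarrow> 'v operator" where
  "cphase d V n i j = fourier d V j \<circ> cshift d V n i j \<circ> adjoint_op d V (fourier d V j)"

definition weighted_graph :: "'v set \<Rightarrow> ('v \<Rightarrow> 'v \<Rightarrow> int) \<Rightarrow> bool" where
  "weighted_graph V \<Gamma> \<longleftrightarrow> finite V \<and>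
     (\<forall>i\<in>V. \<forall>j\<in>V. \<Gamma> i j = \<Gamma> j i) \<and> (\<forall>i\<in>V. \<Gamma> i i = 0)"

definition edges :: "'v set \<Rightarrow> ('v \<Rightarrow> 'v \<Rightarrow> int) \<Rightarrow> 'v set set" where
  "edges V \<Gamma> = {{i, j} | i j. i \<in> V \<and> j \<in> V \<and> i \<noteq> j \<and> \<Gamma> i j \<noteq> 0}"

text \<open>The product of a finite family of pairwise commuting operators.\<close>

definition comm_prod :: "('a \<Rightarrow> 'v operator) \<Rightarrow> 'a set \<Rightarrow> 'v operator" where
  "comm_prod f A = Finite_Set.fold (\<lambda>x T. f x \<circ> T) id A"

text \<open>
  The factor \<open>u(i,j)\<close> raised to \<open>\<Gamma> i j\<close>, for an unordered pair \<open>{i,j}\<close>. It does not depend on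
  the order of \<open>i\<close> and \<open>j\<close>: see \<open>edge_phase_eq\<close> below.
\<close>

definition edge_phase :: "nat \<Rightarrow> 'v set \<Rightarrow> ('v \<Rightarrow> 'v \<Rightarrow> int) \<Rightarrow> 'v set \<Rightarrow> 'v operator" where
  "edge_phase d V \<Gamma> e = (THE U. \<exists>i j. i \<noteq> j \<and> e = {i, j} \<and> U = cphase d V (\<Gamma> i j) i j)"

definition cluster_op :: "nat \<Rightarrow> 'v set \<Rightarrow> ('v \<Rightarrow> 'v \<Rightarrow> int) \<Rightarrow> 'v operator" where
  "cluster_op d V \<Gamma> =
     comm_prod (edge_phase d V \<Gamma>) {e. e \<subseteq> V \<and> card e = 2} \<circ> comm_prod (fourier d V) V"


subsection \<open>The factors are well defined and commute\<close>

lemma finite_labels: "finite V \<Longrightarrow> finite (labels d V)"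
  unfolding labels_def by (intro finite_PiE) auto

lemma labels_upd: "g \<in> labels d V \<Longrightarrow> i \<in> V \<Longrightarrow> 0 \<le> k \<Longrightarrow> k < int d \<Longrightarrow> g(i := k) \<in> labels d V"
  unfolding labels_def by (auto simp: PiE_iff extensional_def)

lemma labels_bounds: "g \<in> labels d V \<Longrightarrow> i \<in> V \<Longrightarrow> 0 \<le> g i \<and> g i < int d"
  unfolding labels_def by (auto simp: PiE_iff)

lemma inner_adjoint:
  assumes "finite V" "\<psi> \<in> l2 d V" "\<phi> \<in> l2 d V"
  shows "inner_l2 d V (lin_ext d V B \<phi>) \<psi> = inner_l2 d V \<phi> (adjoint_op d V (lin_ext d V B) \<psi>)"
proof -
  have ket: "lin_ext d V B (ket g) = B g" if "g \<in> labels d V" for g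
    using that finite_labels[OF assms(1)]
    by (auto simp: lin_ext_def ket_def if_distrib[of "\<lambda>z. z * _"] sum.delta cong: if_cong)
  have "inner_l2 d V (lin_ext d V B \<phi>) \<psi>
      = (\<Sum>h\<in>labels d V. \<Sum>g\<in>labels d V. cnj (\<phi> g) * (cnj (B g h) * \<psi> h))"
    by (simp add: inner_l2_def lin_ext_def sum_distrib_right mult.assoc)
  also have "\<dots> = (\<Sum>g\<in>labels d V. \<Sum>h\<in>labels d V. cnj (\<phi> g) * (cnj (B g h) * \<psi> h))"
    by (rule sum.swap)
  also have "\<dots> = inner_l2 d V \<phi> (adjoint_op d V (lin_ext d V B) \<psi>)"
    by (simp add: inner_l2_def adjoint_op_def ket sum_distrib_left)
  finally show ?thesis .
qed

lemma sum_line: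
  fixes f :: "('v \<Rightarrow> int) \<Rightarrow> complex"
  assumes "finite V" "h \<in> labels d V" "i \<in> V"
    and "\<And>g. g \<in> labels d V \<Longrightarrow> g \<notin> (\<lambda>k. h(i := k)) ` {0..<int d} \<Longrightarrow> f g = 0"
  shows "(\<Sum>g\<in>labels d V. f g) = (\<Sum>k\<in>{0..<int d}. f (h(i := k)))"
proof -
  have inj: "inj_on (\<lambda>k. h(i := k)) {0..<int d}"
    by (auto intro!: inj_onI dest: fun_cong[of _ _ i])
  have "(\<Sum>g\<in>labels d V. f g) = (\<Sum>g\<in>(\<lambda>k. h(i := k)) ` {0..<int d}. f g)"
    using assms by (intro sum.mono_neutral_right) (auto simp: finite_labels labels_upd)
  then show ?thesis by (simp add: sum.reindex[OF inj])
qed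

lemma fourier_apply:
  assumes "finite V" "i \<in> V"
  shows "fourier d V i \<psi> h = (if h \<in> labels d V
     then 1 / of_real (sqrt (real d)) * (\<Sum>k\<in>{0..<int d}. chi d k (h i) * \<psi> (h(i := k))) else 0)"
proof (cases "h \<in> labels d V")
  case False
  have "ket (g(i := k)) h = 0" if "g \<in> labels d V" "k \<in> {0..<int d}" for g k
    using False labels_upd[of g d V i k] that assms by (auto simp: ket_def)
  with False show ?thesis by (simp add: fourier_def lin_ext_def)
next
  case True
  let ?s = "1 / of_real (sqrt (real d)) :: complex"
  let ?f = "\<lambda>g. \<psi> g * (?s * (\<Sum>k\<in>{0..<int d}. chi d (g i) k * ket (g(i := k)) h))"
  have z: "?f g = 0" if g: "g \<in> labels d V" "g \<notin> (\<lambda>k. h(i := k)) ` {0..<int d}" for g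
  proof -
    have "h \<noteq> g(i := k)" for k
    proof
      assume "h = g(i := k)"
      then have "g = h(i := g i)" by auto
      with g labels_bounds[OF g(1) assms(2)] show False by auto
    qed
    then show ?thesis by (simp add: ket_def)
  qed
  have v: "?f (h(i := m)) = ?s * (chi d m (h i) * \<psi> (h(i := m)))" for m
  proof -
    have "ket (h(i := k)) h = (if k = h i then 1 else 0)" for k
      by (auto simp: ket_def fun_eq_iff)
    then have "(\<Sum>k\<in>{0..<int d}. chi d m k * ket (h(i := k)) h) = chi d m (h i)"
      using labels_bounds[OF True assms(2)]
      by (simp add: if_distrib[of "(*) _"] cong: if_cong)
    then show ?thesis by simp
  qed
  have "fourier d V i \<psi> h = (\<Sum>g\<in>labels d V. ?f g)" by (simp add: fourier_def lin_ext_def)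
  also have "\<dots> = (\<Sum>k\<in>{0..<int d}. ?f (h(i := k)))"
    by (rule sum_line[OF assms(1) True assms(2) z])
  also have "\<dots> = (\<Sum>k\<in>{0..<int d}. ?s * (chi d k (h i) * \<psi> (h(i := k))))"
    by (intro sum.cong refl v)
  finally show ?thesis using True by (simp add: sum_distrib_left)
qed

lemma adjoint_fourier_apply:
  assumes "finite V" "i \<in> V"
  shows "adjoint_op d V (fourier d V i) \<psi> g = (if g \<in> labels d V
     then 1 / of_real (sqrt (real d)) * (\<Sum>k\<in>{0..<int d}. cnj (chi d (g i) k) * \<psi> (g(i := k))) else 0)"
proof (cases "g \<in> labels d V")
  case False
  then show ?thesis by (simp add: adjoint_op_def)
next
  case True
  let ?s = "1 / of_real (sqrt (real d)) :: complex"
  let ?F = "fourier d V i (ket g)"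
  let ?f = "\<lambda>h. cnj (?F h) * \<psi> h"
  have z: "?f h = 0" if h: "h \<in> labels d V" "h \<notin> (\<lambda>k. g(i := k)) ` {0..<int d}" for h
  proof -
    have "h(i := k) \<noteq> g" for k
    proof
      assume "h(i := k) = g"
      then have "h = g(i := h i)" by auto
      with h labels_bounds[OF h(1) assms(2)] show False by auto
    qed
    then show ?thesis by (simp add: fourier_apply[OF assms] ket_def)
  qed
  have v: "?F (g(i := m)) = ?s * chi d (g i) m" if "m \<in> {0..<int d}" for m
  proof -
    have "ket g (g(i := k)) = (if k = g i then 1 else 0)" for k
      by (auto simp: ket_def fun_eq_iff)
    then have "(\<Sum>k\<in>{0..<int d}. chi d k m * ket g (g(i := k))) = chi d (g i) m"
      using labels_bounds[OF True assms(2)]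
      by (simp add: if_distrib[of "(*) _"] cong: if_cong)
    then show ?thesis using that labels_upd[OF True assms(2)] by (simp add: fourier_apply[OF assms])
  qed
  have "adjoint_op d V (fourier d V i) \<psi> g = (\<Sum>h\<in>labels d V. ?f h)"
    using True by (simp add: adjoint_op_def inner_l2_def)
  also have "\<dots> = (\<Sum>k\<in>{0..<int d}. ?f (g(i := k)))"
    by (rule sum_line[OF assms(1) True assms(2) z])
  also have "\<dots> = (\<Sum>k\<in>{0..<int d}. ?s * (cnj (chi d (g i) k) * \<psi> (g(i := k))))"
    by (intro sum.cong refl) (simp add: v)
  finally show ?thesis using True by (simp add: sum_distrib_left)
qed

lemma cshift_apply:
  assumes "finite V" "i \<in> V" "j \<in> V" "i \<noteq> j"
  shows "cshift d V n i j \<psi> h =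
    (if h \<in> labels d V then \<psi> (h(j := (h j - n * h i) mod int d)) else 0)"
proof (cases "h \<in> labels d V")
  case False
  have "ket (g(j := (g j + n * g i) mod int d)) h = 0" if g: "g \<in> labels d V" for g
  proof -
    have "int d > 0" using labels_bounds[OF g assms(2)] by linarith
    then have "g(j := (g j + n * g i) mod int d) \<in> labels d V" using g assms by (intro labels_upd) auto
    with False show ?thesis by (auto simp: ket_def)
  qed
  with False show ?thesis by (simp add: cshift_def lin_ext_def)
next
  case True
  have d: "int d > 0" using labels_bounds[OF True assms(2)] by linarith
  let ?h = "h(j := (h j - n * h i) mod int d)"
  have h: "?h \<in> labels d V" using True assms d by (intro labels_upd) auto
  have iff: "h = g(j := (g j + n * g i) mod int d) \<longleftrightarrow> g = ?h" if g: "g \<in> labels d V" for g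
  proof
    assume a: "h = g(j := (g j + n * g i) mod int d)"
    then have "h j = (g j + n * g i) mod int d" "h i = g i" using assms(4) by auto
    then have "(h j - n * h i) mod int d = g j mod int d" by (simp add: mod_diff_left_eq)
    then have "(h j - n * h i) mod int d = g j" using labels_bounds[OF g assms(3)] by simp
    with a show "g = ?h" by auto
  next
    assume a: "g = ?h"
    then have "g j = (h j - n * h i) mod int d" "g i = h i" using assms(4) by auto
    then have "(g j + n * g i) mod int d = h j mod int d" by (simp add: mod_add_left_eq)
    then have "(g j + n * g i) mod int d = h j" using labels_bounds[OF True assms(3)] by simp
    with a show "h = g(j := (g j + n * g i) mod int d)" by auto
  qed
  have "cshift d V n i j \<psi> h = (\<Sum>g\<in>labels d V. if g = ?h then \<psi> g else 0)"
    unfolding cshift_def lin_ext_def by (intro sum.cong refl) (simp add: ket_def iff)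
  with True h show ?thesis by (simp add: finite_labels[OF assms(1)])
qed

lemma chi_commute: "chi d g h = chi d h g"
  by (simp add: chi_def mult.commute)

lemma chi_add: "chi d (g + g') h = chi d g h * chi d g' h"
  by (simp add: chi_def distrib_left distrib_right flip: exp_add)

lemma chi_cnj: "cnj (chi d g h) = chi d (- g) h"
  by (simp add: chi_def exp_cnj)

lemma chi_0 [simp]: "chi d 0 h = 1"
  by (simp add: chi_def)

lemma chi_power: "chi d g h powi n = chi d (n * g) h"
  by (simp add: chi_def exp_power_int algebra_simps)

lemma chi_mult_period [simp]: "chi d (int d * m) h = 1"
proof (cases "d = 0")
  case False
  then have "chi d (int d * m) h = exp (2 * of_int (m * h) * of_real pi * \<i>)"
    by (simp add: chi_def field_simps)
  then show ?thesis using exp_integer_2pi[of "of_int (m * h)"] by (simp add: mult.assoc)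
qed simp

lemma chi_mod: "chi d (g mod int d) h = chi d g h"
proof -
  have "chi d g h = chi d (g mod int d + int d * (g div int d)) h" by simp
  then show ?thesis by (simp only: chi_add chi_mult_period mult_1_right)
qed

lemma chi_eq_1:
  assumes "d > 0" "chi d 1 m = 1"
  shows "int d dvd m"
proof -
  obtain n :: int where "2 * pi / real d * of_int m = of_int (2 * n) * pi"
    using assms(2) unfolding chi_def exp_eq_1 by auto
  then have "real_of_int m = real_of_int (int d * n)" using assms(1) by (simp add: field_simps)
  then show ?thesis by (metis dvd_triv_left of_int_eq_iff)
qed

lemma sum_chi:
  assumes "d > 0" "\<not> int d dvd m"
  shows "(\<Sum>k\<in>{0..<int d}. chi d k m) = 0"
proof -
  have p: "chi d (int k) m = chi d 1 m ^ k" for k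
    using chi_power[of d 1 m "int k"] by simp
  have "(\<Sum>k\<in>{0..<int d}. chi d k m) = (\<Sum>k<d. chi d 1 m ^ k)"
    by (rule sum.reindex_bij_witness[of _ int nat]) (auto simp flip: p)
  moreover have "chi d 1 m ^ d = 1" using p[of d] chi_mult_period[of d 1 m] by simp
  moreover have "chi d 1 m \<noteq> 1" using chi_eq_1[OF assms(1)] assms(2) by blast
  ultimately show ?thesis using geometric_sum[of "chi d 1 m" d] by simp
qed

lemma cphase_apply:
  assumes "finite V" "i \<in> V" "j \<in> V" "i \<noteq> j"
  shows "cphase d V n i j \<psi> h = (if h \<in> labels d V then chi d (h i) (h j) powi n * \<psi> h else 0)"
proof (cases "h \<in> labels d V")
  case False
  then show ?thesis using assms by (simp add: cphase_def fourier_apply)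
next
  case True
  have hj: "h j \<in> {0..<int d}" using labels_bounds[OF True assms(3)] by simp
  then have d: "d > 0" by auto
  let ?D = "{0..<int d}"
  let ?s = "1 / of_real (sqrt (real d)) :: complex"
  have ss: "?s * ?s = 1 / of_nat d"
    using d by (simp flip: of_real_mult)
  let ?A = "adjoint_op d V (fourier d V j) \<psi>"
  have A: "cshift d V n i j ?A (h(j := k))
      = ?s * (\<Sum>m\<in>?D. chi d (n * h i - k) m * \<psi> (h(j := m)))" if k: "k \<in> ?D" for k
  proof -
    have 1: "h(j := k) \<in> labels d V" using True assms k by (intro labels_upd) auto
    have 2: "h(j := (k - n * h i) mod int d) \<in> labels d V" using True assms d by (intro labels_upd) auto
    show ?thesis
      using 1 2 assms by (simp add: cshift_apply adjoint_fourier_apply chi_mod chi_cnj)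
  qed
  have "cphase d V n i j \<psi> h = ?s * (\<Sum>k\<in>?D. chi d k (h j) * cshift d V n i j ?A (h(j := k)))"
    using True assms by (simp add: cphase_def fourier_apply)
  also have "(\<Sum>k\<in>?D. chi d k (h j) * cshift d V n i j ?A (h(j := k)))
      = (\<Sum>k\<in>?D. chi d k (h j) * (?s * (\<Sum>m\<in>?D. chi d (n * h i - k) m * \<psi> (h(j := m)))))"
    by (intro sum.cong refl) (simp only: A)
  also have "?s * \<dots> = (?s * ?s) * (\<Sum>k\<in>?D. \<Sum>m\<in>?D. chi d k (h j) * chi d (n * h i - k) m * \<psi> (h(j := m)))"
    by (simp add: sum_distrib_left mult_ac)
  also have "(\<Sum>k\<in>?D. \<Sum>m\<in>?D. chi d k (h j) * chi d (n * h i - k) m * \<psi> (h(j := m)))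
      = (\<Sum>m\<in>?D. \<Sum>k\<in>?D. chi d k (h j) * chi d (n * h i - k) m * \<psi> (h(j := m)))"
    by (rule sum.swap)
  also have "\<dots> = (\<Sum>m\<in>?D. if m = h j then of_nat d * (chi d (n * h i) m * \<psi> h) else 0)"
  proof (intro sum.cong refl)
    fix m assume m: "m \<in> ?D"
    have "chi d k (h j) * chi d (n * h i - k) m = chi d (n * h i) m * chi d k (h j - m)" for k
      by (simp add: chi_def algebra_simps diff_divide_distrib add_divide_distrib flip: exp_add)
    then have e: "(\<Sum>k\<in>?D. chi d k (h j) * chi d (n * h i - k) m * \<psi> (h(j := m)))
        = chi d (n * h i) m * \<psi> (h(j := m)) * (\<Sum>k\<in>?D. chi d k (h j - m))"
      by (simp add: sum_distrib_left mult_ac)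
    show "(\<Sum>k\<in>?D. chi d k (h j) * chi d (n * h i - k) m * \<psi> (h(j := m)))
        = (if m = h j then of_nat d * (chi d (n * h i) m * \<psi> h) else 0)"
    proof (cases "m = h j")
      case True
      then show ?thesis unfolding e by (simp add: chi_commute[of d _ 0])
    next
      case False
      have "\<not> int d dvd h j - m"
      proof
        assume "int d dvd h j - m"
        then have "h j mod int d = m mod int d" by (simp add: mod_eq_dvd_iff)
        with hj m False show False by simp
      qed
      with False show ?thesis unfolding e by (simp add: sum_chi[OF d])
    qed
  qed
  also have "\<dots> = of_nat d * (chi d (n * h i) (h j) * \<psi> h)" using hj by simp
  finally show ?thesis using True d unfolding ss by (simp add: chi_power)
qed

lemma cphase_swap:
  assumes "finite V" "i \<in> V" "j \<in> V" "i \<noteq> j"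
  shows "cphase d V n i j = cphase d V n j i"
  using assms by (auto simp: fun_eq_iff cphase_apply chi_commute)

lemma edge_phase_eq:
  assumes "weighted_graph V \<Gamma>" "i \<in> V" "j \<in> V" "i \<noteq> j"
  shows "edge_phase d V \<Gamma> {i, j} = cphase d V (\<Gamma> i j) i j"
  unfolding edge_phase_def
proof (rule the_equality)
  fix U assume "\<exists>k l. k \<noteq> l \<and> {i, j} = {k, l} \<and> U = cphase d V (\<Gamma> k l) k l"
  then show "U = cphase d V (\<Gamma> i j) i j"
    using assms cphase_swap[of V i j] by (auto simp: weighted_graph_def doubleton_eq_iff)
qed (use assms in auto)

lemma edge_phase_commute:
  assumes "weighted_graph V \<Gamma>" "e \<subseteq> V" "card e = 2" "e' \<subseteq> V" "card e' = 2"
  shows "edge_phase d V \<Gamma> e \<circ> edge_phase d V \<Gamma> e' = edge_phase d V \<Gamma> e' \<circ> edge_phase d V \<Gamma> e"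
proof -
  obtain i j k l where "e = {i, j}" "i \<noteq> j" "e' = {k, l}" "k \<noteq> l"
    using assms(3,5) by (auto simp: card_2_iff)
  moreover have "finite V" using assms(1) by (simp add: weighted_graph_def)
  ultimately show ?thesis
    using assms by (auto simp: edge_phase_eq fun_eq_iff cphase_apply)
qed

lemma fourier_commute:
  assumes "finite V" "i \<in> V" "j \<in> V"
  shows "fourier d V i \<circ> fourier d V j = fourier d V j \<circ> fourier d V i"
proof (cases "i = j")
  case False
  let ?D = "{0..<int d}"
  let ?s = "1 / of_real (sqrt (real d)) :: complex"
  have *: "fourier d V i (fourier d V j \<psi>) h = (?s * ?s) *
      (\<Sum>k\<in>?D. \<Sum>m\<in>?D. chi d k (h i) * (chi d m (h j) * \<psi> (h(i := k, j := m))))"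
    if "h \<in> labels d V" "i \<in> V" "j \<in> V" "i \<noteq> j" for \<psi> h i j
  proof -
    have "fourier d V i (fourier d V j \<psi>) h = ?s * (\<Sum>k\<in>?D. chi d k (h i) * fourier d V j \<psi> (h(i := k)))"
      using that assms(1) by (simp add: fourier_apply)
    also have "(\<Sum>k\<in>?D. chi d k (h i) * fourier d V j \<psi> (h(i := k))) = (\<Sum>k\<in>?D. chi d k (h i) *
        (?s * (\<Sum>m\<in>?D. chi d m (h j) * \<psi> (h(i := k, j := m)))))"
      by (intro sum.cong refl arg_cong2[where f = "(*)"])
        (use that assms(1) in \<open>simp add: fourier_apply labels_upd\<close>)
    finally show ?thesis by (simp add: sum_distrib_left mult_ac)
  qed
  have "fourier d V i (fourier d V j \<psi>) h = fourier d V j (fourier d V i \<psi>) h" for \<psi> h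
  proof (cases "h \<in> labels d V")
    case True
    have "(\<Sum>k\<in>?D. \<Sum>m\<in>?D. chi d k (h i) * (chi d m (h j) * \<psi> (h(i := k, j := m))))
        = (\<Sum>m\<in>?D. \<Sum>k\<in>?D. chi d m (h j) * (chi d k (h i) * \<psi> (h(j := m, i := k))))"
      by (subst sum.swap) (use False in \<open>simp add: fun_upd_twist mult_ac\<close>)
    then show ?thesis
      using True assms False by (simp only: * not_sym[OF False] not_False_eq_True simp_thms)
  qed (use assms in \<open>simp add: fourier_apply\<close>)
  then show ?thesis by (auto simp: fun_eq_iff)
qed simp

lemma comm_prod_insert:
  assumes "finite A" "x \<notin> A"
    and comm: "\<And>a b. a \<in> insert x A \<Longrightarrow> b \<in> insert x A \<Longrightarrow> f a \<circ> f b = f b \<circ> f a"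
  shows "comm_prod f (insert x A) = f x \<circ> comm_prod f A"
proof -
  interpret comp_fun_commute_on "insert x A" "\<lambda>x T. f x \<circ> T"
    by unfold_locales (use comm in \<open>auto simp: fun_eq_iff\<close>)
  show ?thesis unfolding comm_prod_def using assms(1,2) by (intro fold_insert) auto
qed

end

(*
  Proof idea: build the cluster state one vertex at a time. When a vertex x is added to A, the
  Fourier transform at x commutes with all phase gates inside A, so the new factors are the phase
  gates u(i,x) followed on the right by F_x. As u(i,x)^n = F_x c(i,x)^n F_x^*, the inner Fourier
  transforms cancel and these factors collapse to F_x times one controlled shift per new edge.
*)
theory Submission
  imports Defs
begin

section \<open>Unitarity of the gates\<close>

lemma lin_ext_ket:
  assumes "finite V" "g \<in> labels d V"
  shows "lin_ext d V B (ket g) = B g"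
  using assms finite_labels[OF assms(1)]
  by (auto simp: lin_ext_def ket_def if_distrib[of "\<lambda>z. z * _"] sum.delta cong: if_cong)

text \<open>Additivity and homogeneity come from the defining sum; closure has to be assumed because
  \<open>B\<close> may take nonzero values off \<open>labels d V\<close>.\<close>

lemma linear_op_lin_ext:
  assumes "\<And>\<psi>. lin_ext d V B \<psi> \<in> l2 d V"
  shows "linear_op d V (lin_ext d V B)"
proof -
  have "lin_ext d V B (\<lambda>g. \<phi> g + \<psi> g) = (\<lambda>g. lin_ext d V B \<phi> g + lin_ext d V B \<psi> g)" for \<phi> \<psi>
    by (simp add: lin_ext_def distrib_right sum.distrib)
  moreover have "lin_ext d V B (\<lambda>g. c * \<psi> g) = (\<lambda>g. c * lin_ext d V B \<psi> g)" for c \<psi>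
    by (simp add: lin_ext_def sum_distrib_left mult.assoc)
  ultimately show ?thesis using assms by (simp add: linear_op_def)
qed

lemma fourier_in_l2: "finite V \<Longrightarrow> i \<in> V \<Longrightarrow> fourier d V i \<psi> \<in> l2 d V"
  by (simp add: l2_def fourier_apply)

lemma cshift_in_l2:
  "finite V \<Longrightarrow> i \<in> V \<Longrightarrow> j \<in> V \<Longrightarrow> i \<noteq> j \<Longrightarrow> cshift d V n i j \<psi> \<in> l2 d V"
  by (simp add: l2_def cshift_apply)

text \<open>The gate permutes the basis vectors, so its adjoint is the inverse permutation, which
  shifts back by the same multiple of the control.\<close>

lemma adjoint_cshift:
  assumes "finite V" "i \<in> V" "j \<in> V" "i \<noteq> j"
  shows "adjoint_op d V (cshift d V n i j) = cshift d V (- n) i j"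
proof (intro ext)
  fix \<psi> g
  show "adjoint_op d V (cshift d V n i j) \<psi> g = cshift d V (- n) i j \<psi> g"
  proof (cases "g \<in> labels d V")
    case True
    let ?g = "g(j := (g j + n * g i) mod int d)"
    \<comment> \<open>Positivity of \<open>d\<close> is not among the assumptions: it follows from
      the existence of a residue at the vertex \<open>i\<close>.\<close>
    have "int d > 0" using labels_bounds[OF True assms(2)] by linarith
    then have g: "?g \<in> labels d V" using True assms by (intro labels_upd) auto
    have "adjoint_op d V (cshift d V n i j) \<psi> g = inner_l2 d V (ket ?g) \<psi>"
      using True by (simp add: adjoint_op_def cshift_def lin_ext_ket[OF assms(1)])
    also have "\<dots> = \<psi> ?g"
      using g by (simp add: inner_l2_def ket_def if_distrib[of cnj] if_distrib[of "\<lambda>z. z * _"]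
          finite_labels[OF assms(1)] cong: if_cong)
    finally show ?thesis using True assms by (simp add: cshift_apply)
  qed (use assms in \<open>simp add: adjoint_op_def cshift_apply\<close>)
qed

text \<open>The control entry is left alone by the first shift, so the second one subtracts exactly
  what was added. Off \<open>labels d V\<close> both sides vanish, the right one because
  \<open>\<psi>\<close> lies in \<open>l2 d V\<close>.\<close>

lemma cshift_uminus_cancel:
  assumes "finite V" "i \<in> V" "j \<in> V" "i \<noteq> j" "\<psi> \<in> l2 d V"
  shows "cshift d V (- n) i j (cshift d V n i j \<psi>) = \<psi>"
proof
  fix h
  show "cshift d V (- n) i j (cshift d V n i j \<psi>) h = \<psi> h"
  proof (cases "h \<in> labels d V")
    case True
    have "int d > 0" using labels_bounds[OF True assms(2)] by linarith
    then have "h(j := (h j + n * h i) mod int d) \<in> labels d V"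
      using True assms by (intro labels_upd) auto
    moreover have "((h j + n * h i) mod int d - n * h i) mod int d = h j"
      using labels_bounds[OF True assms(3)] by (simp add: mod_diff_left_eq)
    ultimately show ?thesis using True assms by (simp add: cshift_apply)
  qed (use assms in \<open>simp add: cshift_apply l2_def\<close>)
qed

lemma unitary_cshift:
  assumes "finite V" "i \<in> V" "j \<in> V" "i \<noteq> j"
  shows "unitary_op d V (cshift d V n i j)"
proof -
  have "linear_op d V (cshift d V n i j)"
    using cshift_in_l2[OF assms] unfolding cshift_def by (rule linear_op_lin_ext)
  then show ?thesis
    \<comment> \<open>Exponent \<open>n\<close> gives the left inverse law, exponent
      \<open>- n\<close> the right one.\<close>
    using cshift_uminus_cancel[OF assms, of _ d n] cshift_uminus_cancel[OF assms, of _ d "- n"]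
    by (simp add: unitary_op_def adjoint_cshift[OF assms])
qed

text \<open>The Fourier matrix is symmetric since \<open>chi\<close> is, so its adjoint is its
  entrywise conjugate. This transfers one inverse law to the other.\<close>

lemma fourier_conv_adjoint:
  assumes "finite V" "i \<in> V"
  shows "fourier d V i \<psi> = (\<lambda>h. cnj (adjoint_op d V (fourier d V i) (\<lambda>g. cnj (\<psi> g)) h))"
  using assms by (auto simp: fourier_apply adjoint_fourier_apply chi_commute[of d "_ i"])

text \<open>Orthogonality of characters: the sum over \<open>k\<close> of
  \<open>chi d k (h i - m)\<close> is \<open>d\<close> for \<open>m = h i\<close> and 0 otherwise,
  and \<open>d\<close> cancels the two normalising factors.\<close>

lemma fourier_adjoint_cancel:
  assumes "finite V" "i \<in> V" "\<psi> \<in> l2 d V"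
  shows "fourier d V i (adjoint_op d V (fourier d V i) \<psi>) = \<psi>"
proof
  fix h
  let ?s = "1 / of_real (sqrt (real d)) :: complex"
  let ?D = "{0..<int d}"
  show "fourier d V i (adjoint_op d V (fourier d V i) \<psi>) h = \<psi> h"
  proof (cases "h \<in> labels d V")
    case True
    have hi: "h i \<in> ?D" using labels_bounds[OF True assms(2)] by simp
    then have d: "d > 0" by auto
    have "fourier d V i (adjoint_op d V (fourier d V i) \<psi>) h
        = ?s * (\<Sum>k\<in>?D. chi d k (h i) * (?s * (\<Sum>m\<in>?D. chi d (- k) m * \<psi> (h(i := m)))))"
      using True assms by (simp add: fourier_apply adjoint_fourier_apply labels_upd chi_cnj)
    also have "\<dots> = (?s * ?s) * (\<Sum>k\<in>?D. \<Sum>m\<in>?D. chi d k (h i - m) * \<psi> (h(i := m)))"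
    proof -
      have "chi d k (h i) * chi d (- k) m = chi d k (h i - m)" for k m
        by (simp add: chi_def algebra_simps diff_divide_distrib flip: exp_add)
      then have e: "chi d k (h i) * (?s * (chi d (- k) m * z)) = ?s * (chi d k (h i - m) * z)"
        for k m z
        by (metis mult.assoc mult.left_commute)
      show ?thesis by (simp only: sum_distrib_left e mult.assoc)
    qed
    also have "?s * ?s = 1 / of_nat d" using d by (simp flip: of_real_mult)
    also have "(\<Sum>k\<in>?D. \<Sum>m\<in>?D. chi d k (h i - m) * \<psi> (h(i := m)))
        = (\<Sum>m\<in>?D. (\<Sum>k\<in>?D. chi d k (h i - m)) * \<psi> (h(i := m)))"
      by (subst sum.swap) (simp add: sum_distrib_right)
    also have "\<dots> = (\<Sum>m\<in>?D. if m = h i then of_nat d * \<psi> h else 0)"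
    proof (intro sum.cong refl)
      fix m assume m: "m \<in> ?D"
      have "\<not> int d dvd h i - m" if "m \<noteq> h i"
      proof
        assume "int d dvd h i - m"
        then have "h i mod int d = m mod int d" by (simp add: mod_eq_dvd_iff)
        with hi m that show False by simp
      qed
      then show "(\<Sum>k\<in>?D. chi d k (h i - m)) * \<psi> (h(i := m))
          = (if m = h i then of_nat d * \<psi> h else 0)"
        \<comment> \<open>For \<open>m = h i\<close> the character has second argument 0;
          \<open>chi_commute\<close> moves the 0 to the front, where \<open>chi_0\<close> applies to
          each of the \<open>d\<close> terms.\<close>
        by (auto simp: sum_chi[OF d] chi_commute[of d _ 0])
    qed
    finally show ?thesis using hi d by simp
  qed (use assms in \<open>simp add: fourier_apply l2_def\<close>)
qed

text \<open>With \<open>C\<close> the complex conjugation of functions, \<open>F = C F' C\<close>,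
  where \<open>F'\<close> is the adjoint of \<open>F\<close>. Conjugating the law
  \<open>F F' = id\<close> by \<open>C\<close> yields \<open>F' F = id\<close> without a second
  character sum.\<close>

lemma adjoint_fourier_cancel:
  assumes "finite V" "i \<in> V" "\<psi> \<in> l2 d V"
  shows "adjoint_op d V (fourier d V i) (fourier d V i \<psi>) = \<psi>"
proof -
  define C :: "(('a \<Rightarrow> int) \<Rightarrow> complex) \<Rightarrow> ('a \<Rightarrow> int) \<Rightarrow> complex" where "C = (\<lambda>\<psi> h. cnj (\<psi> h))"
  have C: "C (C \<phi>) = \<phi>" for \<phi> by (simp add: C_def)
  have F: "fourier d V i \<phi> = C (adjoint_op d V (fourier d V i) (C \<phi>))" for \<phi>
    using fourier_conv_adjoint[OF assms(1,2)] by (simp add: C_def)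
  have "C \<psi> \<in> l2 d V" using assms(3) by (simp add: l2_def C_def)
  then have "fourier d V i (adjoint_op d V (fourier d V i) (C \<psi>)) = C \<psi>"
    by (rule fourier_adjoint_cancel[OF assms(1,2)])
  then show ?thesis by (metis C F)
qed

lemma unitary_fourier:
  assumes "finite V" "i \<in> V"
  shows "unitary_op d V (fourier d V i)"
proof -
  have "linear_op d V (fourier d V i)"
    using fourier_in_l2[OF assms] unfolding fourier_def by (rule linear_op_lin_ext)
  then show ?thesis
    using assms by (simp add: unitary_op_def fourier_adjoint_cancel adjoint_fourier_cancel)
qed


section \<open>Circuits of elementary gates\<close>

definition elementary_gate :: "nat \<Rightarrow> 'v set \<Rightarrow> 'v operator \<Rightarrow> bool" where
  "elementary_gate d V U \<longleftrightarrow> unitary_op d V U \<and>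
     ((\<exists>i\<in>V. U = fourier d V i) \<or>
      (\<exists>i\<in>V. \<exists>j\<in>V. \<exists>n. i \<noteq> j \<and> U = cshift d V n i j))"

lemma elementary_gate_fourier: "finite V \<Longrightarrow> i \<in> V \<Longrightarrow> elementary_gate d V (fourier d V i)"
  using unitary_fourier[of V i d] by (auto simp: elementary_gate_def)

lemma elementary_gate_cshift:
  "finite V \<Longrightarrow> i \<in> V \<Longrightarrow> j \<in> V \<Longrightarrow> i \<noteq> j \<Longrightarrow> elementary_gate d V (cshift d V n i j)"
  using unitary_cshift[of V i j d n] by (auto simp: elementary_gate_def)

text \<open>The inverse laws for the Fourier transform hold only on \<open>l2 d V\<close>, so every
  intermediate state must be known to stay there.\<close>

lemma circuit_in_l2:
  assumes "\<forall>U\<in>set Us. elementary_gate d V U" "\<psi> \<in> l2 d V"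
  shows "foldr (\<circ>) Us id \<psi> \<in> l2 d V"
  using assms by (induction Us) (auto simp: elementary_gate_def unitary_op_def linear_op_def)

lemma foldr_comp_append: "foldr (\<circ>) (xs @ ys) id \<psi> = foldr (\<circ>) xs id (foldr (\<circ>) ys id \<psi>)"
  by (induction xs) auto

section \<open>Products of commuting operators\<close>

lemma comm_prod_empty: "comm_prod f {} = id"
  by (simp add: comm_prod_def)

text \<open>Separates the pairs at a new vertex from the old pairs. Commutation is demanded across
  the whole union, as the fold is independent of the order only then.\<close>

lemma comm_prod_Un:
  assumes "finite A" "finite B" "A \<inter> B = {}"
    and "\<And>a b. a \<in> A \<union> B \<Longrightarrow> b \<in> A \<union> B \<Longrightarrow> f a \<circ> f b = f b \<circ> f a"
  shows "comm_prod f (A \<union> B) = comm_prod f A \<circ> comm_prod f B"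
  using assms(1,3,4)
proof (induction A)
  case (insert x A)
  have comm: "f a \<circ> f b = f b \<circ> f a" if "a \<in> insert x (A \<union> B)" "b \<in> insert x (A \<union> B)" for a b
    using that by (intro insert.prems) auto
  have IH: "comm_prod f (A \<union> B) = comm_prod f A \<circ> comm_prod f B"
    using insert.prems(1) by (intro insert.IH comm) auto
  have "comm_prod f (insert x (A \<union> B)) = f x \<circ> comm_prod f (A \<union> B)"
    using insert assms(2) by (intro comm_prod_insert comm) auto
  also have "\<dots> = (f x \<circ> comm_prod f A) \<circ> comm_prod f B"
    by (simp only: IH comp_assoc)
  also have "f x \<circ> comm_prod f A = comm_prod f (insert x A)"
    using insert.hyps by (intro comm_prod_insert[symmetric] comm) auto
  finally show ?case by simp
qed (simp add: comm_prod_empty)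

lemma comm_prod_commute:
  assumes "finite A"
    and "\<And>a b. a \<in> A \<Longrightarrow> b \<in> A \<Longrightarrow> f a \<circ> f b = f b \<circ> f a"
    and "\<And>a. a \<in> A \<Longrightarrow> f a \<circ> T = T \<circ> f a"
  shows "comm_prod f A \<circ> T = T \<circ> comm_prod f A"
proof -
  \<comment> \<open>The induction runs over subsets of the fixed set \<open>A\<close>, so that the
    commutation assumptions need not be carried along.\<close>
  have "comm_prod f B \<circ> T = T \<circ> comm_prod f B" if "finite B" "B \<subseteq> A" for B
    using that
  proof (induction B)
    case (insert x B)
    have *: "comm_prod f (insert x B) = f x \<circ> comm_prod f B"
      using insert.hyps insert.prems by (intro comm_prod_insert assms(2)) auto
    have "f x \<circ> T = T \<circ> f x"
      using insert.prems by (intro assms(3)) auto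
    then have fT: "f x \<circ> (T \<circ> R) = T \<circ> (f x \<circ> R)" for R
      by (metis comp_assoc)
    have IH: "comm_prod f B \<circ> T = T \<circ> comm_prod f B"
      using insert by blast
    show ?case by (simp only: * comp_assoc IH fT)
  qed (simp add: comm_prod_empty)
  with assms(1) show ?thesis by simp
qed


section \<open>Adding a vertex\<close>

text \<open>The key cancellation: the phase gate is the shift conjugated by the Fourier transform at
  its target, and the inner adjoint meets the transform already applied.\<close>

lemma cphase_fourier:
  assumes "finite V" "j \<in> V" "\<psi> \<in> l2 d V"
  shows "cphase d V n i j (fourier d V j \<psi>) = fourier d V j (cshift d V n i j \<psi>)"
  using assms by (simp add: cphase_def adjoint_fourier_cancel)

text \<open>Pairs of weight 0 cost no gate, which is why the count involves edges and not all
  pairs.\<close>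

lemma cphase_0:
  assumes "finite V" "i \<in> V" "j \<in> V" "i \<noteq> j" "\<psi> \<in> l2 d V"
  shows "cphase d V 0 i j \<psi> = \<psi>"
  using assms by (auto simp: fun_eq_iff cphase_apply l2_def)

text \<open>The phase gate is diagonal with entries depending only on the coordinates
  \<open>i\<close> and \<open>j\<close>, while the Fourier transform at \<open>x\<close> alters only
  the coordinate \<open>x\<close>.\<close>

lemma cphase_fourier_commute:
  assumes "finite V" "i \<in> V" "j \<in> V" "i \<noteq> j" "x \<in> V" "x \<noteq> i" "x \<noteq> j"
  shows "cphase d V n i j \<circ> fourier d V x = fourier d V x \<circ> cphase d V n i j"
proof (intro ext)
  fix \<psi> h
  show "(cphase d V n i j \<circ> fourier d V x) \<psi> h = (fourier d V x \<circ> cphase d V n i j) \<psi> h"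
  proof (cases "h \<in> labels d V")
    case True
    with assms show ?thesis
      by (simp add: cphase_apply fourier_apply labels_upd sum_distrib_left mult_ac)
  qed (use assms in \<open>simp add: cphase_apply fourier_apply\<close>)
qed

text \<open>All phase gates at \<open>x\<close> share one Fourier transform: each passes through it
  in turn by \<open>cphase_fourier\<close> and becomes a shift with target \<open>x\<close>.\<close>

lemma star_circuit:
  assumes G: "weighted_graph V \<Gamma>" and x: "x \<in> V" and B: "B \<subseteq> V" "x \<notin> B"
  shows "\<exists>Us. length Us = card {i \<in> B. \<Gamma> i x \<noteq> 0} \<and> (\<forall>U\<in>set Us. elementary_gate d V U) \<and>
    (\<forall>\<psi>\<in>l2 d V. comm_prod (edge_phase d V \<Gamma>) ((\<lambda>i. {i, x}) ` B) (fourier d V x \<psi>)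
       = fourier d V x (foldr (\<circ>) Us id \<psi>))"
proof -
  have fin: "finite V" using G by (simp add: weighted_graph_def)
  then have "finite B" using B(1) by (rule rev_finite_subset)
  then show ?thesis using B
  proof (induction B)
    case empty
    show ?case by (intro exI[of _ "[]"]) (simp add: comm_prod_empty)
  next
    case (insert b B)
    then have "B \<subseteq> V" "x \<notin> B" by auto
    from insert.IH[OF this] obtain Us where Us: "length Us = card {i \<in> B. \<Gamma> i x \<noteq> 0}"
        "\<forall>U\<in>set Us. elementary_gate d V U"
        "\<And>\<psi>. \<psi> \<in> l2 d V \<Longrightarrow> comm_prod (edge_phase d V \<Gamma>) ((\<lambda>i. {i, x}) ` B) (fourier d V x \<psi>)
           = fourier d V x (foldr (\<circ>) Us id \<psi>)"
      by blast
    have b: "b \<in> V" "b \<noteq> x" "b \<notin> B" using insert by auto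
    have "comm_prod (edge_phase d V \<Gamma>) (insert {b, x} ((\<lambda>i. {i, x}) ` B))
        = edge_phase d V \<Gamma> {b, x} \<circ> comm_prod (edge_phase d V \<Gamma>) ((\<lambda>i. {i, x}) ` B)"
      using insert x
      by (intro comm_prod_insert edge_phase_commute[OF G]) (auto simp: doubleton_eq_iff card_insert_if)
    then have step: "comm_prod (edge_phase d V \<Gamma>) ((\<lambda>i. {i, x}) ` insert b B) (fourier d V x \<psi>)
        = cphase d V (\<Gamma> b x) b x (fourier d V x (foldr (\<circ>) Us id \<psi>))" if "\<psi> \<in> l2 d V" for \<psi>
      using Us(3)[OF that] by (simp add: edge_phase_eq[OF G b(1) x b(2)])
    have card: "card {i \<in> insert b B. \<Gamma> i x \<noteq> 0}
        = (if \<Gamma> b x = 0 then 0 else 1) + card {i \<in> B. \<Gamma> i x \<noteq> 0}"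
    proof -
      have "{i \<in> insert b B. \<Gamma> i x \<noteq> 0}
          = (if \<Gamma> b x = 0 then {} else {b}) \<union> {i \<in> B. \<Gamma> i x \<noteq> 0}"
        by auto
      then show ?thesis using insert.hyps by simp
    qed
    show ?case
    proof (cases "\<Gamma> b x = 0")
      case True
      have "cphase d V (\<Gamma> b x) b x (fourier d V x \<phi>) = fourier d V x \<phi>" for \<phi>
        using True b x fin by (simp add: cphase_0 fourier_in_l2)
      then show ?thesis
        using Us(1,2) True by (intro exI[of _ Us] conjI ballI) (simp_all only: card step, simp_all)
    next
      case False
      \<comment> \<open>The new shift stands at the head because \<open>foldr\<close> applies the
        head last: it acts on the output of \<open>Us\<close>, just before the Fourier
        transform.\<close>
      let ?Ws = "cshift d V (\<Gamma> b x) b x # Us"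
      have "cphase d V (\<Gamma> b x) b x (fourier d V x (foldr (\<circ>) Us id \<psi>))
          = fourier d V x (foldr (\<circ>) ?Ws id \<psi>)" if "\<psi> \<in> l2 d V" for \<psi>
        using cphase_fourier[OF fin x circuit_in_l2[OF Us(2) that]] by simp
      moreover have "\<forall>U\<in>set ?Ws. elementary_gate d V U"
        using Us(2) elementary_gate_cshift[OF fin b(1) x b(2)] by simp
      ultimately show ?thesis
        using Us(1) False by (intro exI[of _ ?Ws] conjI ballI) (simp_all only: card step, simp_all)
    qed
  qed
qed

section \<open>Pairs and edges gained with a new vertex\<close>

lemma edges_insert:
  assumes "x \<notin> A" "\<forall>i\<in>A. \<Gamma> i x = \<Gamma> x i"
  shows "edges (insert x A) \<Gamma> = edges A \<Gamma> \<union> (\<lambda>i. {i, x}) ` {i \<in> A. \<Gamma> i x \<noteq> 0}"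
  using assms unfolding edges_def by (auto simp: doubleton_eq_iff)

text \<open>The new edges all contain \<open>x\<close>, hence differ from the old ones, and each is
  determined by its other endpoint.\<close>

lemma card_edges_insert:
  assumes "finite A" "x \<notin> A" "\<forall>i\<in>A. \<Gamma> i x = \<Gamma> x i"
  shows "card (edges (insert x A) \<Gamma>) = card (edges A \<Gamma>) + card {i \<in> A. \<Gamma> i x \<noteq> 0}"
proof -
  let ?S = "(\<lambda>i. {i, x}) ` {i \<in> A. \<Gamma> i x \<noteq> 0}"
  have "edges A \<Gamma> \<subseteq> Pow A" by (auto simp: edges_def)
  then have fin: "finite (edges A \<Gamma>)" using assms(1) finite_subset by blast
  have disj: "edges A \<Gamma> \<inter> ?S = {}" using assms(2) by (auto simp: edges_def doubleton_eq_iff)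
  have "card (edges (insert x A) \<Gamma>) = card (edges A \<Gamma> \<union> ?S)"
    by (simp add: edges_insert[of x A \<Gamma>] assms(2,3))
  also have "\<dots> = card (edges A \<Gamma>) + card ?S"
    using fin disj assms(1) by (intro card_Un_disjoint) auto
  also have "card ?S = card {i \<in> A. \<Gamma> i x \<noteq> 0}"
    by (intro card_image inj_onI) (auto simp: doubleton_eq_iff)
  finally show ?thesis .
qed

lemma pairs_insert:
  assumes "x \<notin> A"
  shows "{e. e \<subseteq> insert x A \<and> card e = 2} = (\<lambda>i. {i, x}) ` A \<union> {e. e \<subseteq> A \<and> card e = 2}"
  using assms by (auto simp: card_2_iff)

text \<open>Induction on a vertex subset \<open>A\<close>, with all operators still acting on the
  full space over \<open>V\<close>; the Hilbert space thus stays fixed while the graph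
  grows.\<close>

lemma cluster_circuit:
  assumes G: "weighted_graph V \<Gamma>" and "A \<subseteq> V"
  shows "\<exists>Us. length Us = card A + card (edges A \<Gamma>) \<and> (\<forall>U\<in>set Us. elementary_gate d V U) \<and>
    (\<forall>\<psi>\<in>l2 d V. comm_prod (edge_phase d V \<Gamma>) {e. e \<subseteq> A \<and> card e = 2}
        (comm_prod (fourier d V) A \<psi>) = foldr (\<circ>) Us id \<psi>)"
proof -
  have fin: "finite V" using G by (simp add: weighted_graph_def)
  then have "finite A" using assms(2) by (rule rev_finite_subset)
  then show ?thesis using assms(2)
  proof (induction A)
    case empty
    \<comment> \<open>\<open>conj_cong\<close> lets \<open>e = {}\<close> refute
      \<open>card e = 2\<close>, so that the product over pairs is empty too.\<close>
    show ?case by (intro exI[of _ "[]"]) (simp add: comm_prod_empty edges_def cong: conj_cong)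
  next
    case (insert x A)
    let ?E = "edge_phase d V \<Gamma>" and ?F = "fourier d V"
    let ?P = "{e. e \<subseteq> A \<and> card e = 2}" and ?S = "(\<lambda>i. {i, x}) ` A"
    have x: "x \<in> V" "x \<notin> A" "A \<subseteq> V" using insert by auto
    obtain Us where Us: "length Us = card A + card (edges A \<Gamma>)"
        "\<forall>U\<in>set Us. elementary_gate d V U"
        "\<And>\<psi>. \<psi> \<in> l2 d V \<Longrightarrow> comm_prod ?E ?P (comm_prod ?F A \<psi>) = foldr (\<circ>) Us id \<psi>"
      using insert.IH[OF x(3)] by blast
    obtain Ws where Ws: "length Ws = card {i \<in> A. \<Gamma> i x \<noteq> 0}"
        "\<forall>U\<in>set Ws. elementary_gate d V U"
        "\<And>\<psi>. \<psi> \<in> l2 d V \<Longrightarrow> comm_prod ?E ?S (?F x \<psi>) = ?F x (foldr (\<circ>) Ws id \<psi>)"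
      using star_circuit[OF G x(1,3,2)] by blast
    have finP: "finite ?P" using insert.hyps(1) by simp
    have EU: "comm_prod ?E (?S \<union> ?P) = comm_prod ?E ?S \<circ> comm_prod ?E ?P"
    proof (rule comm_prod_Un)
      fix a b assume "a \<in> ?S \<union> ?P" "b \<in> ?S \<union> ?P"
      moreover have "c \<subseteq> V \<and> card c = 2" if "c \<in> ?S \<union> ?P" for c
        using that x by (auto simp: card_2_iff)
      ultimately show "?E a \<circ> ?E b = ?E b \<circ> ?E a"
        by (metis edge_phase_commute[OF G])
    qed (use insert.hyps finP in auto)
    have FI: "comm_prod ?F (insert x A) = ?F x \<circ> comm_prod ?F A"
      using insert.hyps x by (intro comm_prod_insert fourier_commute[OF fin]) auto
    \<comment> \<open>No old pair contains \<open>x\<close>, so the new Fourier transform can move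
      left past all old phase gates.\<close>
    have EF: "comm_prod ?E ?P \<circ> ?F x = ?F x \<circ> comm_prod ?E ?P"
    proof (rule comm_prod_commute[OF finP])
      show "?E a \<circ> ?E b = ?E b \<circ> ?E a" if "a \<in> ?P" "b \<in> ?P" for a b
        using that x by (intro edge_phase_commute[OF G]) auto
      show "?E e \<circ> ?F x = ?F x \<circ> ?E e" if e: "e \<in> ?P" for e
      proof -
        obtain i j where ij: "e = {i, j}" "i \<noteq> j" using e by (auto simp: card_2_iff)
        then have "i \<in> V" "j \<in> V" "x \<noteq> i" "x \<noteq> j" using e x by auto
        then show ?thesis
          using ij x(1) by (simp add: edge_phase_eq[OF G] cphase_fourier_commute[OF fin])
      qed
    qed
    have "comm_prod ?E (?S \<union> ?P) (comm_prod ?F (insert x A) \<psi>)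
        = comm_prod ?E ?S (?F x (comm_prod ?E ?P (comm_prod ?F A \<psi>)))" for \<psi>
      using fun_cong[OF EF, of "comm_prod ?F A \<psi>"] by (simp only: EU FI comp_apply)
    \<comment> \<open>In order of action: \<open>Us\<close> builds the state for \<open>A\<close>,
      then \<open>Ws\<close> performs the shifts onto \<open>x\<close>, then a single Fourier
      transform acts at \<open>x\<close>.\<close>
    then have "comm_prod ?E (?S \<union> ?P) (comm_prod ?F (insert x A) \<psi>)
        = foldr (\<circ>) (?F x # Ws @ Us) id \<psi>" if "\<psi> \<in> l2 d V" for \<psi>
      using Us(3)[OF that] Ws(3)[OF circuit_in_l2[OF Us(2) that]]
      by (simp add: foldr_comp_append del: foldr_append)
    moreover have "length (?F x # Ws @ Us) = card (insert x A) + card (edges (insert x A) \<Gamma>)"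
    proof -
      have "\<forall>i\<in>A. \<Gamma> i x = \<Gamma> x i" using G x by (auto simp: weighted_graph_def)
      then show ?thesis using insert.hyps Us(1) Ws(1) by (simp add: card_edges_insert)
    qed
    moreover have "\<forall>U\<in>set (?F x # Ws @ Us). elementary_gate d V U"
      using Us(2) Ws(2) elementary_gate_fourier[OF fin x(1)] by auto
    ultimately show ?case unfolding pairs_insert[OF x(2)] by blast
  qed
qed

theorem mainTheorem1:
  fixes d :: nat and V :: "'v set" and \<Gamma> :: "'v \<Rightarrow> 'v \<Rightarrow> int"
  assumes "d > 0" and "weighted_graph V \<Gamma>"
  shows "\<exists>Us :: 'v operator list.
    length Us = card V + card (edges V \<Gamma>) \<and>
    (\<forall>U\<in>set Us. unitary_op d V U \<and>
       ((\<exists>i\<in>V. U = fourier d V i) \<or>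
        (\<exists>i\<in>V. \<exists>j\<in>V. \<exists>n. i \<noteq> j \<and> U = cshift d V n i j))) \<and>
    (\<forall>\<psi>\<in>l2 d V. cluster_op d V \<Gamma> \<psi> = foldr (\<circ>) Us id \<psi>)"
  \<comment> \<open>The case \<open>A = V\<close>, where the two products are exactly those of
    \<open>cluster_op\<close>.\<close>
  using cluster_circuit[OF assms(2) order_refl, of d]
  by (simp add: cluster_op_def elementary_gate_def)

end
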